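(* Let $N\ge 2$ be an integer and consider the generalized eigenvalue problem: find $\lambda^N\in\mathbb{R}$ and $(\vec{u},\vec{v})\neq(0,0)$, with $\vec{u}=\mathrm{vec}(\mathbf{U})$, $\mathbf{U}\in\mathbb{R}^{N\times(N-1)}$, and $\vec{v}=\mathrm{vec}(\mathbf{V})$, $\mathbf{V}\in\mathbb{R}^{(N-1)\times N}$, such that $$ \begin{pmatrix} \mathbf{I}_{N-1}\otimes\mathbf{I}_N & -\mathbf{E}\otimes\mathbf{E}^{\top}\\ -\mathbf{E}^{\top}\otimes\mathbf{E} & \mathbf{I}_N\otimes\mathbf{I}_{N-1} \end{pmatrix} \begin{pmatrix}\vec{u}\\ \vec{v}\end{pmatrix} =\lambda^N \begin{pmatrix} \mathbf{M}\otimes\mathbf{I}_N & 0\\ 0 & \mathbf{I}_N\otimes\mathbf{M} \end{pmatrix} \begin{pmatrix}\vec{u}\\ \vec{v}\end{pmatrix}. $$ Then the eigen-solutions $(\lambda^N,\mathbf{U},\mathbf{V})$ of this problem are exactly the following, in the sense that each triple listed is an eigen-solution and every eigenvector with eigenvalue $\lambda$ is a linear combination of the listed eigenvectors with eigenvalue $\lambda$. (A) Eigen-solutions $(\lambda^N_{ij},\mathbf{U}_{ij},\mathbf{V}_{ij})$ with non-zero eigenvalue: (A1) For $1\le i,j\le N-1$: $$\lambda_{ij}^N=\frac1{d_i}+\frac1{d_j},\qquad \mathbf{U}_{ij}=\begin{bmatrix}\vec{0}^{\top}\\ \mathbf{U}^1_{ij}\end{bmatrix},\qquad \mathbf{V}_{ij}=\begin{bmatrix}\vec{0}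 & \mathbf{U}^2_{ij}\end{bmatrix},$$ with $$\mathbf{U}^1_{ij}=\mathbf{Q}\,\mathbf{I}_{ij}\,\mathbf{Q}^{\top},\qquad \mathbf{U}^2_{ij}=-\mathbf{Q}\Big(\frac{d_j}{d_i}\,\mathbf{I}_{ij}\Big)\mathbf{Q}^{\top}.$$ (A2) For $i=0$ and $1\le j\le N-1$: $$\lambda_{0j}^N=\frac1{d_j},\qquad \mathbf{U}_{0j}=\begin{bmatrix}\mathbf{Q}(:,j)^{\top}\\ \mathbf{0}_{N-1}\end{bmatrix},\qquad \mathbf{V}_{0j}=\begin{bmatrix}\vec{0} & \mathbf{0}_{N-1}\end{bmatrix}.$$ (A3) For $j=0$ and $1\le i\le N-1$: $$\lambda_{i0}^N=\frac1{d_i},\qquad \mathbf{U}_{i0}=\begin{bmatrix}\vec{0}^{\top}\\ \mathbf{0}_{N-1}\end{bmatrix},\qquad \mathbf{V}_{i0}=\begin{bmatrix}\mathbf{Q}(:,i) & \mathbf{0}_{N-1}\end{bmatrix}.$$ (B) Eigen-solutions with zero eigenvalue: for $1\le i,j\le N-1$, $$\lambda^N_{ij}=0,\qquad \mathbf{U}_{ij}=\begin{bmatrix}\vec{0}^{\top}\\ \mathbf{U}^1_{ij}\end{bmatrix},\qquad \mathbf{V}_{ij}=\begin{bmatrix}\vec{0} & \mathbf{U}^2_{ij}\end{bmatrix},\qquad \mathbf{U}^1_{ij}=\mathbf{U}^2_{ij}=\mathbf{I}_{ij}.$$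
   Context: Notation. $\mathbf{I}_n$ and $\mathbf{0}_n$ are the $n\times n$ identity and zero matrices; $\vec 0$ is the zero column vector of length $N-1$. $\otimes$ is the Kronecker product and $\mathrm{vec}$ is the column-wise (column-stacking) vectorization, so that $(\mathbf{A}\otimes\mathbf{B})\,\mathrm{vec}(\mathbf{X})=\mathrm{vec}(\mathbf{B}\mathbf{X}\mathbf{A}^{\top})$. The matrix $\mathbf{E}\in\mathbb{R}^{(N-1)\times N}$ is $\mathbf{I}_N$ with its first row removed, so its rows are the transposes of the 2nd to $N$-th canonical basis vectors of $\mathbb{R}^N$. $\mathbf{Q}(:,j)$ is the $j$-th column of $\mathbf{Q}$. $\mathbf{I}_{ij}$ is the $(N-1)\times(N-1)$ matrix whose $(i,j)$ entry is $1$ and whose other entries are $0$. In block notation, $\begin{bmatrix} a^{\top}\\ X\end{bmatrix}$ is the $N\times(N-1)$ matrix with first row $a^\top$ followed by the rows of $X$, and $\begin{bmatrix} a & X\end{bmatrix}$ is the $(N-1)\times N$ matrix with first column $a$ followed by the columns of $X$. The matrix $\mathbf{M}=(M_{mn})_{1\le m,n\le N-1}$ is the symmetric (positive definite) Gram matrix $M_{mn}=\int_{-1}^1\psi_{n+1}(\xi)\psi_{m+1}(\xi)\,d\xi$, where $\psi_{m+1}(\xi)=\frac{1}{\sqrt{2(2m+1)}}\big(L_{m+1}(\xi)-L_{m-1}(\xi)\big)$ and $L_m$ is the Legendre polynomial of degree $m$. Explicitly, $M_{nn}=\frac{1}{2n+1}\big(\frac1{2n-1}+\frac1{2n+3}\big)$,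 $M_{n+2,n}=M_{n,n+2}=-\frac{1}{\sqrt{2n+1}\,\sqrt{2n+5}\,(2n+3)}$, and all other entries are $0$. $\mathbf{M}=\mathbf{Q}\mathbf{D}\mathbf{Q}^{\top}$ is an orthogonal diagonalization: $\mathbf{Q}\mathbf{Q}^{\top}=\mathbf{Q}^{\top}\mathbf{Q}=\mathbf{I}_{N-1}$ and $\mathbf{D}=\mathrm{diag}(d_1,\dots,d_{N-1})$, where the $d_i>0$ are the eigenvalues of $\mathbf{M}$. The generalized eigenvalue problem is the algebraic form of the $H(\mathrm{curl})$-conforming Legendre spectral discretization of the two-dimensional Maxwell double-curl eigenvalue problem on $(-1,1)^2$. *)

theory Defs
  imports
    "HOL-Analysis.Analysis"
    "HOL-Computational_Algebra.Polynomial"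
    "Jordan_Normal_Form.Matrix"
    "Jordan_Normal_Form.VS_Connect"
begin

text \<open>
  Matrices are those of \<^theory>\<open>Jordan_Normal_Form.Matrix\<close>, indexed from 0: entry \<open>(i, j)\<close>
  here is entry \<open>(i + 1, j + 1)\<close> in the usual 1-based notation.
\<close>

definition kronecker :: "real mat \<Rightarrow> real mat \<Rightarrow> real mat" where
  "kronecker A B = Matrix.mat (dim_row A * dim_row B) (dim_col A * dim_col B)
     (\<lambda>(i, j). A $$ (i div dim_row B, j div dim_col B) * B $$ (i mod dim_row B, j mod dim_col B))"

text \<open>Column-stacking vectorization.\<close>
definition vectorize :: "real mat \<Rightarrow> real Matrix.vec" where
  "vectorize X = Matrix.vec (dim_row X * dim_col X)
     (\<lambda>k. X $$ (k mod dim_row X, k div dim_row X))"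

text \<open>Horizontal counterpart of \<^const>\<open>append_rows\<close>.\<close>
definition append_cols :: "real mat \<Rightarrow> real mat \<Rightarrow> real mat" where
  "append_cols A B = four_block_mat A B (0\<^sub>m 0 (dim_col A)) (0\<^sub>m 0 (dim_col B))"

text \<open>The identity of size \<open>N\<close> without its first row.\<close>
definition shift_mat :: "nat \<Rightarrow> real mat" where
  "shift_mat N = Matrix.mat (N - 1) N (\<lambda>(i, j). if j = i + 1 then 1 else 0)"

definition unit_mat :: "nat \<Rightarrow> nat \<Rightarrow> nat \<Rightarrow> real mat" where
  "unit_mat n i j = Matrix.mat n n (\<lambda>(k, l). if k = i \<and> l = j then 1 else 0)"

text \<open>Legendre polynomials, by Rodrigues' formula.\<close>
definition legendre :: "nat \<Rightarrow> real poly" where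
  "legendre n = Polynomial.smult (1 / (2 ^ n * fact n)) ((pderiv ^^ n) ([:-1, 0, 1:] ^ n))"

text \<open>
  \<open>psi m\<close> is $\psi_{m+1}$ (so the argument is the $m$ occurring in the normalizing factor);
  it is only meaningful for \<open>m \<ge> 1\<close>.
\<close>
definition psi :: "nat \<Rightarrow> real \<Rightarrow> real" where
  "psi m x = 1 / sqrt (2 * (2 * real m + 1)) *
     (poly (legendre (m + 1)) x - poly (legendre (m - 1)) x)"

text \<open>The Gram matrix; \<open>m + 1\<close> and \<open>n + 1\<close> are the 1-based indices.\<close>
definition gram_mat :: "nat \<Rightarrow> real mat" where
  "gram_mat N = Matrix.mat (N - 1) (N - 1)
     (\<lambda>(m, n). integral {-1..1} (\<lambda>x. psi (n + 1) x * psi (m + 1) x))"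

definition lhs_mat :: "nat \<Rightarrow> real mat" where
  "lhs_mat N = four_block_mat
     (kronecker (1\<^sub>m (N - 1)) (1\<^sub>m N))
     (- kronecker (shift_mat N) (transpose_mat (shift_mat N)))
     (- kronecker (transpose_mat (shift_mat N)) (shift_mat N))
     (kronecker (1\<^sub>m N) (1\<^sub>m (N - 1)))"

definition rhs_mat :: "nat \<Rightarrow> real mat" where
  "rhs_mat N = four_block_mat
     (kronecker (gram_mat N) (1\<^sub>m N))
     (0\<^sub>m ((N - 1) * N) (N * (N - 1)))
     (0\<^sub>m (N * (N - 1)) ((N - 1) * N))
     (kronecker (1\<^sub>m N) (gram_mat N))"

definition pair_vec :: "real mat \<Rightarrow> real mat \<Rightarrow> real Matrix.vec" where
  "pair_vec U V = vectorize U @\<^sub>v vectorize V"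

definition eigen_solution :: "nat \<Rightarrow> real \<Rightarrow> real mat \<Rightarrow> real mat \<Rightarrow> bool" where
  "eigen_solution N \<mu> U V \<longleftrightarrow>
     U \<in> carrier_mat N (N - 1) \<and> V \<in> carrier_mat (N - 1) N \<and>
     pair_vec U V \<noteq> 0\<^sub>v (2 * (N * (N - 1))) \<and>
     lhs_mat N *\<^sub>v pair_vec U V = \<mu> \<cdot>\<^sub>v (rhs_mat N *\<^sub>v pair_vec U V)"

definition row_block :: "real Matrix.vec \<Rightarrow> real mat \<Rightarrow> real mat" where
  "row_block a X = mat_of_row a @\<^sub>r X"

definition col_block :: "real Matrix.vec \<Rightarrow> real mat \<Rightarrow> real mat" where
  "col_block a X = append_cols (mat_of_cols (dim_vec a) [a]) X"

text \<open>
  The three families of eigen-solutions \<open>(\<mu>, U, V)\<close> with non-zero eigenvalue, followed by the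
  family with zero eigenvalue. The matrix \<open>Q\<close> and the diagonal \<open>d\<close> come from an orthogonal
  diagonalization of the Gram matrix.
\<close>

definition solutions_A1 ::
  "nat \<Rightarrow> real mat \<Rightarrow> (nat \<Rightarrow> real) \<Rightarrow> (real \<times> real mat \<times> real mat) set" where
  "solutions_A1 N Q d =
     {(1 / d i + 1 / d j,
       row_block (0\<^sub>v (N - 1)) (Q * unit_mat (N - 1) i j * transpose_mat Q),
       col_block (0\<^sub>v (N - 1)) (- (Q * ((d j / d i) \<cdot>\<^sub>m unit_mat (N - 1) i j) * transpose_mat Q)))
      | i j. i < N - 1 \<and> j < N - 1}"

definition solutions_A2 ::
  "nat \<Rightarrow> real mat \<Rightarrow> (nat \<Rightarrow> real) \<Rightarrow> (real \<times> real mat \<times> real mat) set" where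
  "solutions_A2 N Q d =
     {(1 / d j,
       row_block (col Q j) (0\<^sub>m (N - 1) (N - 1)),
       col_block (0\<^sub>v (N - 1)) (0\<^sub>m (N - 1) (N - 1)))
      | j. j < N - 1}"

definition solutions_A3 ::
  "nat \<Rightarrow> real mat \<Rightarrow> (nat \<Rightarrow> real) \<Rightarrow> (real \<times> real mat \<times> real mat) set" where
  "solutions_A3 N Q d =
     {(1 / d i,
       row_block (0\<^sub>v (N - 1)) (0\<^sub>m (N - 1) (N - 1)),
       col_block (col Q i) (0\<^sub>m (N - 1) (N - 1)))
      | i. i < N - 1}"

definition nonzero_solutions ::
  "nat \<Rightarrow> real mat \<Rightarrow> (nat \<Rightarrow> real) \<Rightarrow> (real \<times> real mat \<times> real mat) set" where
  "nonzero_solutions N Q d = solutions_A1 N Q d \<union> solutions_A2 N Q d \<union> solutions_A3 N Q d"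

definition solutions_B :: "nat \<Rightarrow> (real \<times> real mat \<times> real mat) set" where
  "solutions_B N =
     {(0,
       row_block (0\<^sub>v (N - 1)) (unit_mat (N - 1) i j),
       col_block (0\<^sub>v (N - 1)) (unit_mat (N - 1) i j))
      | i j. i < N - 1 \<and> j < N - 1}"

definition vec_span :: "nat \<Rightarrow> real Matrix.vec set \<Rightarrow> real Matrix.vec set" where
  "vec_span n S = LinearCombinations.module.span class_ring (module_vec TYPE(real) n) S"

end

theory Submission
  imports Defs
begin

text \<open>
  Let $n = N - 1$ and write $U$ as a first row $a^{\top}$ followed by a square matrix $X$, and $V$
  as a first column $b$ followed by a square matrix $Y$. By
  $(A \otimes B)\,\mathrm{vec}(X) = \mathrm{vec}(B X A^{\top})$ (lemma
  \<open>kronecker_mult_vectorize\<close>) the eigenvalue problem is a pair of matrix equations, and since $E$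
  only deletes or inserts a first row or column it decouples (lemma \<open>eigen_solution_block_iff\<close>)
  into
  \[ a = \mu M a, \qquad b = \mu M b, \qquad X - Y = \mu X M, \qquad Y - X = \mu M Y. \]

  The Gram matrix $M$ is positive definite because the functions defining it are polynomials of
  distinct degrees (lemma \<open>gram_mat_pos_def\<close>), so every $d_j$ is positive. That the listed triples
  are eigen-solutions is then a substitution, as the matrices $Q I_{ij} Q^{\top}$ are eigenvectors
  of left and right multiplication by $M$.

  Conversely, for an eigen-solution expand $a$ and $b$ in the columns of $Q$: a coordinate is
  non-zero only if $\mu = 1/d_j$, which yields combinations of \<open>solutions_A2\<close> and
  \<open>solutions_A3\<close>. If $\mu = 0$ then $X = Y$, a combination of \<open>solutions_B\<close>. If
  $\mu \neq 0$, expand $X$ and $Y$ in the $Q I_{ij} Q^{\top}$ with coordinates $x_{ij}$ and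
  $y_{ij}$; the coupled equations force $y_{ij} = -(d_j/d_i) x_{ij}$, and
  $\mu = 1/d_i + 1/d_j$ wherever $x_{ij} \neq 0$, which is a combination of
  \<open>solutions_A1\<close> (lemmas \<open>block_in_span_zero\<close> and \<open>block_in_span_nonzero\<close>).
\<close>

(* From here on "$" denotes entries of vectors of type Matrix.vec. *)
unbundle no vec_syntax

section \<open>Kronecker products and vectorization\<close>

lemma kronecker_carrier [simp, intro]:
  assumes "A \<in> carrier_mat p q" and "B \<in> carrier_mat r s"
  shows "kronecker A B \<in> carrier_mat (p * r) (q * s)"
  using assms by (auto simp: kronecker_def)

lemma vectorize_carrier [simp, intro]:
  assumes "X \<in> carrier_mat p q"
  shows "vectorize X \<in> carrier_vec (p * q)"
  using assms by (auto simp: vectorize_def)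

lemma div_less_of_mult:
  fixes k p r :: nat
  assumes "k < p * r"
  shows "k div r < p" "k mod r < r"
  using assms by (auto simp: less_mult_imp_div_less) (metis mod_less_divisor mult_0_right neq0_conv not_less0)

lemma mult_add_less:
  fixes i j p q :: nat
  assumes "i < p" and "j < q"
  shows "j * p + i < p * q"
proof -
  have "j * p + i < Suc j * p" using assms by simp
  also have "\<dots> \<le> q * p" using assms by (intro mult_le_mono1) simp
  finally show ?thesis by (simp add: mult.commute)
qed

lemma vectorize_index:
  assumes "X \<in> carrier_mat p q" and "i < p" and "j < q"
  shows "vectorize X $ (j * p + i) = X $$ (i, j)"
  using assms mult_add_less[of i p j q] by (auto simp: vectorize_def)

lemma vectorize_eq_iff:
  assumes X: "X \<in> carrier_mat p q" and Y: "Y \<in> carrier_mat p q"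
  shows "vectorize X = vectorize Y \<longleftrightarrow> X = Y"
proof
  assume eq: "vectorize X = vectorize Y"
  show "X = Y"
  proof (rule eq_matI)
    fix i j assume "i < dim_row Y" "j < dim_col Y"
    then show "X $$ (i, j) = Y $$ (i, j)"
      using vectorize_index[OF X, of i j] vectorize_index[OF Y, of i j] Y eq by simp
  qed (use X Y in auto)
qed simp

lemma vectorize_add:
  assumes "X \<in> carrier_mat p q" and "Y \<in> carrier_mat p q"
  shows "vectorize (X + Y) = vectorize X + vectorize Y"
  using assms by (auto simp: vectorize_def div_less_of_mult mult.commute intro!: eq_vecI)

lemma vectorize_minus:
  assumes "X \<in> carrier_mat p q" and "Y \<in> carrier_mat p q"
  shows "vectorize (X - Y) = vectorize X - vectorize Y"
  using assms by (auto simp: vectorize_def div_less_of_mult mult.commute intro!: eq_vecI)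

lemma vectorize_smult:
  assumes "X \<in> carrier_mat p q"
  shows "vectorize (c \<cdot>\<^sub>m X) = c \<cdot>\<^sub>v vectorize X"
  using assms by (auto simp: vectorize_def div_less_of_mult mult.commute intro!: eq_vecI)

lemma vectorize_zero: "vectorize (0\<^sub>m p q) = 0\<^sub>v (p * q)"
  by (auto simp: vectorize_def div_less_of_mult mult.commute intro!: eq_vecI)

lemma kronecker_mult_vectorize:
  assumes A: "A \<in> carrier_mat p q" and B: "B \<in> carrier_mat r s" and X: "X \<in> carrier_mat s q"
  shows "kronecker A B *\<^sub>v vectorize X = vectorize (B * X * transpose_mat A)"
proof (rule eq_vecI)
  have BXA: "B * X * transpose_mat A \<in> carrier_mat r p" using A B X by auto
  show "dim_vec (kronecker A B *\<^sub>v vectorize X) = dim_vec (vectorize (B * X * transpose_mat A))"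
    using A B X by (auto simp: kronecker_def vectorize_def)
  fix k assume "k < dim_vec (vectorize (B * X * transpose_mat A))"
  then have k: "k < p * r" using A B by (auto simp: vectorize_def mult.commute)
  define i j where "i = k div r" and "j = k mod r"
  have ij: "i < p" "j < r" using div_less_of_mult[OF k] by (auto simp: i_def j_def)
  have "(kronecker A B *\<^sub>v vectorize X) $ k
      = (\<Sum>l<q * s. A $$ (i, l div s) * B $$ (j, l mod s) * X $$ (l mod s, l div s))"
    using A B X k
    by (auto simp: kronecker_def vectorize_def scalar_prod_def i_def j_def mult.commute
        lessThan_atLeast0 intro!: sum.cong)
  \<comment> \<open>each block of \<open>s\<close> consecutive entries of the vectorization is one column of \<open>X\<close>\<close>
  also have "\<dots> = (\<Sum>c<q. \<Sum>l=c * s..<c * s + s.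
      A $$ (i, l div s) * B $$ (j, l mod s) * X $$ (l mod s, l div s))"
    by (rule sum.nat_group[symmetric])
  also have "\<dots> = (\<Sum>c<q. \<Sum>e<s. A $$ (i, c) * B $$ (j, e) * X $$ (e, c))"
  proof (rule sum.cong[OF refl])
    fix c
    show "(\<Sum>l=c * s..<c * s + s. A $$ (i, l div s) * B $$ (j, l mod s) * X $$ (l mod s, l div s))
        = (\<Sum>e<s. A $$ (i, c) * B $$ (j, e) * X $$ (e, c))"
      using sum.shift_bounds_nat_ivl[of "\<lambda>l. A $$ (i, l div s) * B $$ (j, l mod s) * X $$ (l mod s, l div s)"
          0 "c * s" s]
      by (simp add: lessThan_atLeast0 add.commute[of s])
  qed
  also have "\<dots> = (\<Sum>c<q. (\<Sum>e<s. B $$ (j, e) * X $$ (e, c)) * A $$ (i, c))"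
    by (simp add: sum_distrib_left sum_distrib_right mult_ac)
  also have "\<dots> = (B * X * transpose_mat A) $$ (j, i)"
    using A B X ij
    by (auto simp: scalar_prod_def lessThan_atLeast0 simp del: assoc_mult_mat intro!: sum.cong)
  also have "\<dots> = vectorize (B * X * transpose_mat A) $ k"
    using vectorize_index[OF BXA ij(2,1)] by (simp add: i_def j_def)
  finally show "(kronecker A B *\<^sub>v vectorize X) $ k
      = vectorize (B * X * transpose_mat A) $ k" .
qed

section \<open>The eigenvalue problem as a pair of matrix equations\<close>

lemma shift_mat_carrier [simp, intro]: "shift_mat N \<in> carrier_mat (N - 1) N"
  by (simp add: shift_mat_def)

lemma gram_mat_carrier [simp, intro]: "gram_mat N \<in> carrier_mat (N - 1) (N - 1)"
  by (simp add: gram_mat_def)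

lemma transpose_gram_mat: "transpose_mat (gram_mat N) = gram_mat N"
  by (auto simp: gram_mat_def mult.commute intro!: eq_matI)

lemma append_vec_smult: "c \<cdot>\<^sub>v (a @\<^sub>v b) = (c \<cdot>\<^sub>v a) @\<^sub>v (c \<cdot>\<^sub>v (b :: real Matrix.vec))"
  by (auto intro!: eq_vecI)

lemma pair_vec_eq_zero_iff:
  assumes U: "U \<in> carrier_mat N (N - 1)" and V: "V \<in> carrier_mat (N - 1) N"
  shows "pair_vec U V = 0\<^sub>v (2 * (N * (N - 1))) \<longleftrightarrow> U = 0\<^sub>m N (N - 1) \<and> V = 0\<^sub>m (N - 1) N"
proof -
  have "0\<^sub>v (2 * (N * (N - 1))) = vectorize (0\<^sub>m N (N - 1)) @\<^sub>v vectorize (0\<^sub>m (N - 1) N)"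
    by (auto simp: vectorize_zero mult.commute intro!: eq_vecI)
  then show ?thesis
    using vectorize_eq_iff[OF U, of "0\<^sub>m N (N - 1)"] vectorize_eq_iff[OF V, of "0\<^sub>m (N - 1) N"]
      append_vec_eq[OF vectorize_carrier[OF U] vectorize_carrier[of "0\<^sub>m N (N - 1)" N "N - 1"]]
    by (simp add: pair_vec_def)
qed

text \<open>
  Undoing the vectorization turns the problem into $U - E^{\top} V E^{\top} = \mu U M$ and
  $V - E U E = \mu M V$; symmetry of \<open>M\<close> removes a transpose from the first right-hand side.
\<close>
lemma eigen_solution_iff:
  fixes N :: nat
  defines "E \<equiv> shift_mat N" and "M \<equiv> gram_mat N"
  shows "eigen_solution N \<mu> U V \<longleftrightarrow>
    U \<in> carrier_mat N (N - 1) \<and> V \<in> carrier_mat (N - 1) N \<and>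
    \<not> (U = 0\<^sub>m N (N - 1) \<and> V = 0\<^sub>m (N - 1) N) \<and>
    U - transpose_mat E * V * transpose_mat E = \<mu> \<cdot>\<^sub>m (U * M) \<and>
    V - E * U * E = \<mu> \<cdot>\<^sub>m (M * V)"
proof (cases "U \<in> carrier_mat N (N - 1) \<and> V \<in> carrier_mat (N - 1) N")
  case True
  then have U: "U \<in> carrier_mat N (N - 1)" and V: "V \<in> carrier_mat (N - 1) N" by auto
  have E: "E \<in> carrier_mat (N - 1) N" and ET: "transpose_mat E \<in> carrier_mat N (N - 1)"
    and M: "M \<in> carrier_mat (N - 1) (N - 1)"
    by (simp_all add: E_def M_def del: One_nat_def)
  have vu: "vectorize U \<in> carrier_vec ((N - 1) * N)" and vv: "vectorize V \<in> carrier_vec (N * (N - 1))"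
    using vectorize_carrier[OF U] vectorize_carrier[OF V] by (simp_all add: mult.commute)
  have K: "kronecker (1\<^sub>m (N - 1)) (1\<^sub>m N) *\<^sub>v vectorize U = vectorize U"
    "kronecker (1\<^sub>m N) (1\<^sub>m (N - 1)) *\<^sub>v vectorize V = vectorize V"
    "kronecker E (transpose_mat E) *\<^sub>v vectorize V = vectorize (transpose_mat E * V * transpose_mat E)"
    "kronecker (transpose_mat E) E *\<^sub>v vectorize U = vectorize (E * U * E)"
    "kronecker M (1\<^sub>m N) *\<^sub>v vectorize U = vectorize (U * M)"
    "kronecker (1\<^sub>m N) M *\<^sub>v vectorize V = vectorize (M * V)"
    using kronecker_mult_vectorize[OF one_carrier_mat one_carrier_mat U]
      kronecker_mult_vectorize[OF one_carrier_mat one_carrier_mat V]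
      kronecker_mult_vectorize[OF E ET V] kronecker_mult_vectorize[OF ET E U]
      kronecker_mult_vectorize[OF M one_carrier_mat U] kronecker_mult_vectorize[OF one_carrier_mat M V]
      left_mult_one_mat[OF U] right_mult_one_mat[OF U] left_mult_one_mat[OF V] right_mult_one_mat[OF V]
      right_mult_one_mat[OF mult_carrier_mat[OF M V]] transpose_gram_mat[of N]
    by (simp_all add: M_def del: One_nat_def)
  have EVE: "transpose_mat E * V * transpose_mat E \<in> carrier_mat N (N - 1)"
    and EUE: "E * U * E \<in> carrier_mat (N - 1) N"
    and UM: "U * M \<in> carrier_mat N (N - 1)" and MV: "M * V \<in> carrier_mat (N - 1) N"
    using U V E M by auto
  have k1: "kronecker (1\<^sub>m (N - 1)) (1\<^sub>m N) \<in> carrier_mat ((N - 1) * N) ((N - 1) * N)"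
    "- kronecker E (transpose_mat E) \<in> carrier_mat ((N - 1) * N) (N * (N - 1))"
    "- kronecker (transpose_mat E) E \<in> carrier_mat (N * (N - 1)) ((N - 1) * N)"
    "kronecker (1\<^sub>m N) (1\<^sub>m (N - 1)) \<in> carrier_mat (N * (N - 1)) (N * (N - 1))"
    "kronecker M (1\<^sub>m N) \<in> carrier_mat ((N - 1) * N) ((N - 1) * N)"
    "kronecker (1\<^sub>m N) M \<in> carrier_mat (N * (N - 1)) (N * (N - 1))"
    using E M by (auto simp del: kronecker_carrier intro!: kronecker_carrier)
  have neg: "x + - A *\<^sub>v y = x - A *\<^sub>v y" "- A *\<^sub>v y + x = x - A *\<^sub>v y"
    if "A \<in> carrier_mat a b" "x \<in> carrier_vec a" "y \<in> carrier_vec b"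
    for A :: "real mat" and x y :: "real Matrix.vec" and a b
    using that by (auto simp: scalar_prod_uminus_left intro!: eq_vecI)
  have lhs: "lhs_mat N *\<^sub>v pair_vec U V =
     vectorize (U - transpose_mat E * V * transpose_mat E) @\<^sub>v vectorize (V - E * U * E)"
  proof -
    have "lhs_mat N *\<^sub>v pair_vec U V
       = (vectorize U + - kronecker E (transpose_mat E) *\<^sub>v vectorize V)
         @\<^sub>v (- kronecker (transpose_mat E) E *\<^sub>v vectorize U + vectorize V)"
      unfolding lhs_mat_def pair_vec_def E_def[symmetric]
      by (subst four_block_mat_mult_vec[OF k1(1,2,3,4) vu vv]) (simp add: K del: One_nat_def)
    also have "- kronecker (transpose_mat E) E *\<^sub>v vectorize U + vectorize V
        = vectorize V - kronecker (transpose_mat E) E *\<^sub>v vectorize U"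
      by (rule neg(2)[OF kronecker_carrier[OF ET E] vv vu])
    also have "vectorize U + - kronecker E (transpose_mat E) *\<^sub>v vectorize V
        = vectorize U - kronecker E (transpose_mat E) *\<^sub>v vectorize V"
      by (rule neg(1)[OF kronecker_carrier[OF E ET] vu vv])
    finally show ?thesis
      unfolding K vectorize_minus[OF U EVE] vectorize_minus[OF V EUE] .
  qed
  have rhs: "\<mu> \<cdot>\<^sub>v (rhs_mat N *\<^sub>v pair_vec U V) =
     vectorize (\<mu> \<cdot>\<^sub>m (U * M)) @\<^sub>v vectorize (\<mu> \<cdot>\<^sub>m (M * V))"
    unfolding rhs_mat_def pair_vec_def M_def[symmetric]
    unfolding mult_mat_vec_split[OF k1(5,6) vu vv] K append_vec_smult
      vectorize_smult[OF UM] vectorize_smult[OF MV] ..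
  have c: "U - transpose_mat E * V * transpose_mat E \<in> carrier_mat N (N - 1)"
     "V - E * U * E \<in> carrier_mat (N - 1) N"
     "\<mu> \<cdot>\<^sub>m (U * M) \<in> carrier_mat N (N - 1)" "\<mu> \<cdot>\<^sub>m (M * V) \<in> carrier_mat (N - 1) N"
    using minus_carrier_mat[OF EVE] minus_carrier_mat[OF EUE] UM MV by auto
  show ?thesis
    unfolding eigen_solution_def lhs rhs pair_vec_eq_zero_iff[OF U V]
      append_vec_eq[OF vectorize_carrier[OF c(1)] vectorize_carrier[OF c(3)]]
      vectorize_eq_iff[OF c(1,3)] vectorize_eq_iff[OF c(2,4)]
    using U V by blast
qed (auto simp: eigen_solution_def)

section \<open>Splitting off the first row and the first column\<close>

lemma row_block_carrier [simp, intro]: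
  assumes "a \<in> carrier_vec m" and "X \<in> carrier_mat n m"
  shows "row_block a X \<in> carrier_mat (Suc n) m"
  using assms by (auto simp: row_block_def append_rows_def)

lemma col_block_carrier [simp, intro]:
  assumes "b \<in> carrier_vec m" and "Y \<in> carrier_mat m n"
  shows "col_block b Y \<in> carrier_mat m (Suc n)"
  using assms by (auto simp: col_block_def append_cols_def)

lemma dim_row_block [simp]:
  "dim_row (row_block a X) = Suc (dim_row X)" "dim_col (row_block a X) = dim_vec a"
  by (simp_all add: row_block_def append_rows_def)

lemma dim_col_block [simp]:
  "dim_row (col_block b Y) = dim_vec b" "dim_col (col_block b Y) = Suc (dim_col Y)"
  by (simp_all add: col_block_def append_cols_def)

lemma row_block_index [simp]:
  assumes "i < Suc (dim_row X)" and "j < dim_vec a"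
  shows "row_block a X $$ (i, j) = (if i = 0 then a $ j else X $$ (i - 1, j))"
  using assms by (auto simp: row_block_def append_rows_def)

lemma col_block_index [simp]:
  assumes "i < dim_vec b" and "j < Suc (dim_col Y)"
  shows "col_block b Y $$ (i, j) = (if j = 0 then b $ i else Y $$ (i, j - 1))"
  using assms by (auto simp: col_block_def append_cols_def mat_of_cols_def)

lemma row_block_eq_iff:
  assumes "a \<in> carrier_vec m" and "X \<in> carrier_mat n m"
    and "a' \<in> carrier_vec m" and "X' \<in> carrier_mat n m"
  shows "row_block a X = row_block a' X' \<longleftrightarrow> a = a' \<and> X = X'"
proof
  assume eq: "row_block a X = row_block a' X'"
  have "a $ j = a' $ j" if "j < m" for j
    using row_block_index[of 0 X j a] row_block_index[of 0 X' j a'] that eq assms by simp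
  moreover have "X $$ (i, j) = X' $$ (i, j)" if "i < n" "j < m" for i j
    using row_block_index[of "Suc i" X j a] row_block_index[of "Suc i" X' j a'] that eq assms by simp
  ultimately show "a = a' \<and> X = X'"
    using assms by auto
qed simp

lemma col_block_eq_iff:
  assumes "b \<in> carrier_vec m" and "Y \<in> carrier_mat m n"
    and "b' \<in> carrier_vec m" and "Y' \<in> carrier_mat m n"
  shows "col_block b Y = col_block b' Y' \<longleftrightarrow> b = b' \<and> Y = Y'"
proof
  assume eq: "col_block b Y = col_block b' Y'"
  have "b $ i = b' $ i" if "i < m" for i
    using col_block_index[of i b 0 Y] col_block_index[of i b' 0 Y'] that eq assms by simp
  moreover have "Y $$ (i, j) = Y' $$ (i, j)" if "i < m" "j < n" for i j
    using col_block_index[of i b "Suc j" Y] col_block_index[of i b' "Suc j" Y'] that eq assms by simp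
  ultimately show "b = b' \<and> Y = Y'"
    using assms by auto
qed simp

lemma eq_row_blockI:
  assumes "A \<in> carrier_mat (Suc n) m" and "a \<in> carrier_vec m" and "X \<in> carrier_mat n m"
    and "\<And>j. j < m \<Longrightarrow> A $$ (0, j) = a $ j"
    and "\<And>i j. i < n \<Longrightarrow> j < m \<Longrightarrow> A $$ (Suc i, j) = X $$ (i, j)"
  shows "A = row_block a X"
proof (rule eq_matI)
  fix i j assume "i < dim_row (row_block a X)" "j < dim_col (row_block a X)"
  then have "i < Suc n" "j < m" using row_block_carrier[OF assms(2,3)] by auto
  then show "A $$ (i, j) = row_block a X $$ (i, j)"
    using assms(4,5) assms(2,3) by (cases i) auto
qed (use assms(1) row_block_carrier[OF assms(2,3)] in auto)

lemma eq_col_blockI: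
  assumes "A \<in> carrier_mat m (Suc n)" and "b \<in> carrier_vec m" and "Y \<in> carrier_mat m n"
    and "\<And>i. i < m \<Longrightarrow> A $$ (i, 0) = b $ i"
    and "\<And>i j. i < m \<Longrightarrow> j < n \<Longrightarrow> A $$ (i, Suc j) = Y $$ (i, j)"
  shows "A = col_block b Y"
proof (rule eq_matI)
  fix i j assume "i < dim_row (col_block b Y)" "j < dim_col (col_block b Y)"
  then have "i < m" "j < Suc n" using col_block_carrier[OF assms(2,3)] by auto
  then show "A $$ (i, j) = col_block b Y $$ (i, j)"
    using assms(4,5) assms(2,3) by (cases j) auto
qed (use assms(1) col_block_carrier[OF assms(2,3)] in auto)

lemma row_block_cases:
  assumes "U \<in> carrier_mat (Suc n) m"
  obtains a X where "a \<in> carrier_vec m" and "X \<in> carrier_mat n m" and "U = row_block a X"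
proof (rule that)
  show "U = row_block (row U 0) (Matrix.mat n m (\<lambda>(i, j). U $$ (Suc i, j)))"
    using assms by (intro eq_row_blockI) auto
qed (use assms in auto)

lemma col_block_cases:
  assumes "V \<in> carrier_mat m (Suc n)"
  obtains b Y where "b \<in> carrier_vec m" and "Y \<in> carrier_mat m n" and "V = col_block b Y"
proof (rule that)
  show "V = col_block (col V 0) (Matrix.mat m n (\<lambda>(i, j). V $$ (i, Suc j)))"
    using assms by (intro eq_col_blockI) auto
qed (use assms in auto)

lemma row_block_minus:
  assumes "a \<in> carrier_vec m" "X \<in> carrier_mat n m" "a' \<in> carrier_vec m" "X' \<in> carrier_mat n m"
  shows "row_block a X - row_block a' X' = row_block (a - a') (X - X')"
  using assms row_block_carrier[OF assms(3,4)]
  by (intro eq_row_blockI) auto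

lemma col_block_minus:
  assumes "b \<in> carrier_vec m" "Y \<in> carrier_mat m n" "b' \<in> carrier_vec m" "Y' \<in> carrier_mat m n"
  shows "col_block b Y - col_block b' Y' = col_block (b - b') (Y - Y')"
  using assms col_block_carrier[OF assms(3,4)]
  by (intro eq_col_blockI) auto

lemma row_block_smult:
  assumes "a \<in> carrier_vec m" "X \<in> carrier_mat n m"
  shows "c \<cdot>\<^sub>m row_block a X = row_block (c \<cdot>\<^sub>v a) (c \<cdot>\<^sub>m X)"
  using assms row_block_carrier[OF assms]
  by (intro eq_row_blockI) auto

lemma col_block_smult:
  assumes "b \<in> carrier_vec m" "Y \<in> carrier_mat m n"
  shows "c \<cdot>\<^sub>m col_block b Y = col_block (c \<cdot>\<^sub>v b) (c \<cdot>\<^sub>m Y)"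
  using assms col_block_carrier[OF assms]
  by (intro eq_col_blockI) auto

lemma row_block_zero: "row_block (0\<^sub>v m) (0\<^sub>m n m) = 0\<^sub>m (Suc n) m"
  by (rule eq_row_blockI[symmetric]) auto

lemma col_block_zero: "col_block (0\<^sub>v m) (0\<^sub>m m n) = 0\<^sub>m m (Suc n)"
  by (rule eq_col_blockI[symmetric]) auto

lemma row_block_mult:
  assumes a: "a \<in> carrier_vec m" and X: "X \<in> carrier_mat n m" and A: "A \<in> carrier_mat m k"
  shows "row_block a X * A = row_block (transpose_mat A *\<^sub>v a) (X * A)"
proof (rule eq_row_blockI)
  fix j assume "j < k"
  then show "(row_block a X * A) $$ (0, j) = (transpose_mat A *\<^sub>v a) $ j"
    using a X A row_block_carrier[OF a X]
    by (auto simp: scalar_prod_def mult.commute intro!: sum.cong)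
next
  fix i j assume "i < n" "j < k"
  then show "(row_block a X * A) $$ (Suc i, j) = (X * A) $$ (i, j)"
    using X A row_block_carrier[OF a X]
    by (auto simp: scalar_prod_def intro!: sum.cong)
qed (use assms row_block_carrier[OF a X] in auto)

lemma mult_col_block:
  assumes b: "b \<in> carrier_vec m" and Y: "Y \<in> carrier_mat m n" and A: "A \<in> carrier_mat k m"
  shows "A * col_block b Y = col_block (A *\<^sub>v b) (A * Y)"
proof (rule eq_col_blockI)
  fix i assume "i < k"
  then show "(A * col_block b Y) $$ (i, 0) = (A *\<^sub>v b) $ i"
    using b Y A col_block_carrier[OF b Y]
    by (auto simp: scalar_prod_def intro!: sum.cong)
next
  fix i j assume "i < k" "j < n"
  then show "(A * col_block b Y) $$ (i, Suc j) = (A * Y) $$ (i, j)"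
    using Y A col_block_carrier[OF b Y]
    by (auto simp: scalar_prod_def intro!: sum.cong)
qed (use assms col_block_carrier[OF b Y] in auto)

lemma shift_mat_mult_row_block:
  assumes a: "a \<in> carrier_vec m" and X: "X \<in> carrier_mat n m"
  shows "shift_mat (Suc n) * row_block a X = X"
proof (rule eq_matI)
  fix i j assume "i < dim_row X" "j < dim_col X"
  then show "(shift_mat (Suc n) * row_block a X) $$ (i, j) = X $$ (i, j)"
    using X row_block_carrier[OF a X]
    by (auto simp: shift_mat_def scalar_prod_def if_distrib[of "\<lambda>x. x * _"]
        sum.delta cong: if_cong)
qed (use X row_block_carrier[OF a X] in \<open>auto simp: shift_mat_def\<close>)

lemma transpose_shift_mat_mult:
  assumes X: "X \<in> carrier_mat n m"
  shows "transpose_mat (shift_mat (Suc n)) * X = row_block (0\<^sub>v m) X"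
proof (rule eq_row_blockI)
  fix i j assume "i < n" "j < m"
  then show "(transpose_mat (shift_mat (Suc n)) * X) $$ (Suc i, j) = X $$ (i, j)"
    using X by (auto simp: shift_mat_def scalar_prod_def if_distrib[of "\<lambda>x. x * _"]
        sum.delta cong: if_cong)
qed (use X in \<open>auto simp: shift_mat_def scalar_prod_def\<close>)

lemma col_block_mult_transpose_shift_mat:
  assumes b: "b \<in> carrier_vec m" and Y: "Y \<in> carrier_mat m n"
  shows "col_block b Y * transpose_mat (shift_mat (Suc n)) = Y"
proof (rule eq_matI)
  fix i j assume "i < dim_row Y" "j < dim_col Y"
  then show "(col_block b Y * transpose_mat (shift_mat (Suc n))) $$ (i, j) = Y $$ (i, j)"
    using Y col_block_carrier[OF b Y]
    by (auto simp: shift_mat_def scalar_prod_def if_distrib[of "\<lambda>x. _ * x"]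
        sum.delta cong: if_cong)
qed (use Y col_block_carrier[OF b Y] in \<open>auto simp: shift_mat_def\<close>)

lemma mult_shift_mat:
  assumes Y: "Y \<in> carrier_mat m n"
  shows "Y * shift_mat (Suc n) = col_block (0\<^sub>v m) Y"
proof (rule eq_col_blockI)
  fix i j assume "i < m" "j < n"
  then show "(Y * shift_mat (Suc n)) $$ (i, Suc j) = Y $$ (i, j)"
    using Y by (auto simp: shift_mat_def scalar_prod_def if_distrib[of "\<lambda>x. _ * x"]
        sum.delta cong: if_cong)
qed (use Y in \<open>auto simp: shift_mat_def scalar_prod_def\<close>)

text \<open>
  Multiplying by the shift matrix removes or restores the first row or column. Hence the equations
  decouple: the first row of \<open>U\<close> and the first column of \<open>V\<close> each solve an eigenvalue problem
  for \<open>M\<close>, and only the square remainders \<open>X\<close> and \<open>Y\<close> interact.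
\<close>
lemma eigen_solution_block_iff:
  fixes n :: nat
  defines "M \<equiv> gram_mat (Suc n)"
  assumes a: "a \<in> carrier_vec n" and X: "X \<in> carrier_mat n n"
    and b: "b \<in> carrier_vec n" and Y: "Y \<in> carrier_mat n n"
  shows "eigen_solution (Suc n) \<mu> (row_block a X) (col_block b Y) \<longleftrightarrow>
    \<not> (a = 0\<^sub>v n \<and> X = 0\<^sub>m n n \<and> b = 0\<^sub>v n \<and> Y = 0\<^sub>m n n) \<and>
    a = \<mu> \<cdot>\<^sub>v (M *\<^sub>v a) \<and> b = \<mu> \<cdot>\<^sub>v (M *\<^sub>v b) \<and>
    X - Y = \<mu> \<cdot>\<^sub>m (X * M) \<and> Y - X = \<mu> \<cdot>\<^sub>m (M * Y)"
proof -
  define E where "E = shift_mat (Suc n)"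
  have E: "E \<in> carrier_mat n (Suc n)" and M: "M \<in> carrier_mat n n"
    using shift_mat_carrier[of "Suc n"] gram_mat_carrier[of "Suc n"] by (simp_all add: E_def M_def)
  have U: "row_block a X \<in> carrier_mat (Suc n) n" and V: "col_block b Y \<in> carrier_mat n (Suc n)"
    using a X b Y by auto
  have "transpose_mat E * col_block b Y * transpose_mat E = row_block (0\<^sub>v n) Y"
    using assoc_mult_mat[OF _ V, of "transpose_mat E" "Suc n" "transpose_mat E" n] E
      col_block_mult_transpose_shift_mat[OF b Y] transpose_shift_mat_mult[OF Y]
    by (simp add: E_def)
  then have 1: "row_block a X - transpose_mat E * col_block b Y * transpose_mat E = row_block a (X - Y)"
    using row_block_minus[OF a X zero_carrier_vec Y] a by simp
  have "E * row_block a X * E = col_block (0\<^sub>v n) X"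
    using shift_mat_mult_row_block[OF a X] mult_shift_mat[OF X] by (simp add: E_def)
  then have 2: "col_block b Y - E * row_block a X * E = col_block b (Y - X)"
    using col_block_minus[OF b Y zero_carrier_vec X] b by simp
  have 3: "\<mu> \<cdot>\<^sub>m (row_block a X * M) = row_block (\<mu> \<cdot>\<^sub>v (M *\<^sub>v a)) (\<mu> \<cdot>\<^sub>m (X * M))"
    using row_block_mult[OF a X M] row_block_smult[of "M *\<^sub>v a" n "X * M" n] a X M
    by (simp add: M_def transpose_gram_mat)
  have 4: "\<mu> \<cdot>\<^sub>m (M * col_block b Y) = col_block (\<mu> \<cdot>\<^sub>v (M *\<^sub>v b)) (\<mu> \<cdot>\<^sub>m (M * Y))"
    using mult_col_block[OF b Y M] col_block_smult[of "M *\<^sub>v b" n "M * Y" n] b Y M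
    by simp
  have 5: "row_block a X = 0\<^sub>m (Suc n) n \<longleftrightarrow> a = 0\<^sub>v n \<and> X = 0\<^sub>m n n"
    using row_block_eq_iff[OF a X zero_carrier_vec zero_carrier_mat] by (simp add: row_block_zero)
  have 6: "col_block b Y = 0\<^sub>m n (Suc n) \<longleftrightarrow> b = 0\<^sub>v n \<and> Y = 0\<^sub>m n n"
    using col_block_eq_iff[OF b Y zero_carrier_vec zero_carrier_mat] by (simp add: col_block_zero)
  have 7: "row_block a (X - Y) = row_block (\<mu> \<cdot>\<^sub>v (M *\<^sub>v a)) (\<mu> \<cdot>\<^sub>m (X * M)) \<longleftrightarrow>
      a = \<mu> \<cdot>\<^sub>v (M *\<^sub>v a) \<and> X - Y = \<mu> \<cdot>\<^sub>m (X * M)"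
    using a X Y M by (intro row_block_eq_iff) auto
  have 8: "col_block b (Y - X) = col_block (\<mu> \<cdot>\<^sub>v (M *\<^sub>v b)) (\<mu> \<cdot>\<^sub>m (M * Y)) \<longleftrightarrow>
      b = \<mu> \<cdot>\<^sub>v (M *\<^sub>v b) \<and> Y - X = \<mu> \<cdot>\<^sub>m (M * Y)"
    using b X Y M by (intro col_block_eq_iff) auto
  show ?thesis
    unfolding eigen_solution_iff E_def[symmetric] M_def[symmetric] 1 2 3 4 diff_Suc_1 5 6 7 8
    using U V by auto
qed

section \<open>Positive definiteness of the Gram matrix\<close>

lemma degree_legendre [simp]: "degree (legendre n) = n"
proof -
  have "degree ([:-1, 0, 1:] ^ n :: real poly) = 2 * n"
    by (subst degree_power_eq) auto
  then show ?thesis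
    by (simp add: legendre_def degree_higher_pderiv)
qed

text \<open>The function \<^term>\<open>psi m\<close> as a polynomial.\<close>
definition psi_poly :: "nat \<Rightarrow> real poly" where
  "psi_poly m = Polynomial.smult (1 / sqrt (2 * (2 * real m + 1))) (legendre (m + 1) - legendre (m - 1))"

lemma psi_eq_poly: "psi m x = poly (psi_poly m) x"
  by (simp add: psi_def psi_poly_def)

lemma degree_psi_poly: "degree (psi_poly m) = m + 1"
proof -
  have "degree (legendre (m + 1) - legendre (m - 1)) = m + 1"
    using degree_add_eq_left[of "- legendre (m - 1)" "legendre (m + 1)"] by simp
  then show ?thesis
    by (simp add: psi_poly_def add_nonneg_eq_0_iff)
qed

lemma independent_of_degree_less:
  fixes p :: "nat \<Rightarrow> 'a :: idom poly"
  assumes deg: "\<And>i j. i < j \<Longrightarrow> degree (p i) < degree (p j)" and nz: "\<And>i. p i \<noteq> 0"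
    and sum: "(\<Sum>i<n. Polynomial.smult (c i) (p i)) = 0" and "i < n"
  shows "c i = 0"
  using sum \<open>i < n\<close>
proof (induction n)
  case (Suc n)
  have "coeff (\<Sum>i<n. Polynomial.smult (c i) (p i)) (degree (p n)) = 0"
    by (auto simp: coeff_sum coeff_eq_0 deg intro!: sum.neutral)
  then have "c n * lead_coeff (p n) = 0"
    using arg_cong[OF Suc.prems(1), of "\<lambda>q. coeff q (degree (p n))"] by simp
  then have "c n = 0" using nz by simp
  then show ?case using Suc by (cases "i = n") auto
qed simp

text \<open>
  The quadratic form at \<open>v\<close> is the integral of the square of the polynomial
  $\sum_i v_i \psi_{i+2}$. It vanishes only if that polynomial is zero, and the $\psi_{i+2}$
  are linearly independent because their degrees $i + 2$ are distinct.
\<close>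
lemma gram_mat_pos_def:
  assumes v: "v \<in> carrier_vec n" and "v \<noteq> 0\<^sub>v n"
  shows "scalar_prod v (gram_mat (Suc n) *\<^sub>v v) > 0"
proof -
  define p where "p = (\<Sum>i<n. Polynomial.smult (v $ i) (psi_poly (i + 1)))"
  have cont: "continuous_on {-1..1} (psi m)" for m
    unfolding psi_eq_poly[abs_def] by (intro continuous_intros)
  have "scalar_prod v (gram_mat (Suc n) *\<^sub>v v)
      = (\<Sum>i<n. \<Sum>j<n. v $ i * v $ j * integral {-1..1} (\<lambda>x. psi (j + 1) x * psi (i + 1) x))"
    using v by (simp add: gram_mat_def scalar_prod_def lessThan_atLeast0 sum_distrib_left mult_ac)
  also have "\<dots> = integral {-1..1} (\<lambda>x. \<Sum>i<n. \<Sum>j<n. v $ i * v $ j * (psi (j + 1) x * psi (i + 1) x))"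
    by (simp add: integral_sum integrable_continuous_real continuous_intros cont)
  also have "(\<lambda>x. \<Sum>i<n. \<Sum>j<n. v $ i * v $ j * (psi (j + 1) x * psi (i + 1) x))
      = (\<lambda>x. (poly p x)\<^sup>2)"
    by (simp add: fun_eq_iff p_def poly_sum psi_eq_poly power2_eq_square sum_product mult_ac)
  finally have eq: "scalar_prod v (gram_mat (Suc n) *\<^sub>v v) = integral {-1..1} (\<lambda>x. (poly p x)\<^sup>2)" .
  have "integral {-1..1} (\<lambda>x. (poly p x)\<^sup>2) \<noteq> 0"
  proof
    assume "integral {-1..1} (\<lambda>x. (poly p x)\<^sup>2) = 0"
    then have "\<forall>x\<in>{-1..1}. poly p x = 0"
      by (subst (asm) integral_eq_0_iff) (auto intro!: continuous_intros)
    then have "{-1..1} \<subseteq> {x. poly p x = 0}" by auto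
    then have "infinite {x. poly p x = 0}"
      by (rule infinite_super) simp
    then have "p = 0"
      using poly_roots_finite by blast
    have "psi_poly (i + 1) \<noteq> 0" for i
      using degree_psi_poly[of "i + 1"] by auto
    with \<open>p = 0\<close> have "v $ i = 0" if "i < n" for i
      using independent_of_degree_less[of "\<lambda>i. psi_poly (i + 1)" "\<lambda>i. v $ i" n i] that
      by (simp add: p_def degree_psi_poly)
    then have "v = 0\<^sub>v n" using v by auto
    with assms show False by simp
  qed
  moreover have "integral {-1..1} (\<lambda>x. (poly p x)\<^sup>2) \<ge> 0"
    by (intro integral_nonneg integrable_continuous_real continuous_intros) auto
  ultimately show ?thesis using eq by simp
qed

section \<open>Spans of pairs of matrices\<close>

lemma pair_vec_carrier:
  assumes "U \<in> carrier_mat N (N - 1)" and "V \<in> carrier_mat (N - 1) N"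
  shows "pair_vec U V \<in> carrier_vec (2 * (N * (N - 1)))"
proof -
  have "pair_vec U V \<in> carrier_vec (N * (N - 1) + (N - 1) * N)"
    unfolding pair_vec_def using assms by (intro append_carrier_vec vectorize_carrier)
  then show ?thesis by (simp add: mult.commute mult_2 del: One_nat_def)
qed

lemma pair_vec_add:
  assumes "U \<in> carrier_mat p q" "V \<in> carrier_mat q p" "U' \<in> carrier_mat p q" "V' \<in> carrier_mat q p"
  shows "pair_vec (U + U') (V + V') = pair_vec U V + pair_vec U' V'"
  unfolding pair_vec_def vectorize_add[OF assms(1,3)] vectorize_add[OF assms(2,4)]
  using append_vec_add[OF vectorize_carrier[OF assms(1)] vectorize_carrier[OF assms(3)]
      vectorize_carrier[OF assms(2)] vectorize_carrier[OF assms(4)]] by simp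

lemma vec_span_add:
  assumes "S \<subseteq> carrier_vec m" and "x \<in> vec_span m S" and "y \<in> vec_span m S"
  shows "x + y \<in> vec_span m S"
proof -
  interpret vec_space "TYPE(real)" m .
  show ?thesis using assms span_add1 by (simp add: vec_span_def)
qed

text \<open>
  A linear combination given entrywise over a finite index set lies in the span. The family \<open>w\<close>
  need not be injective, and \<open>w k\<close> has to lie in \<open>S\<close> only where its coefficient is non-zero.
\<close>
lemma vec_span_sum:
  assumes S: "S \<subseteq> carrier_vec m" and "finite K" and "v \<in> carrier_vec m"
    and "\<And>k. k \<in> K \<Longrightarrow> w k \<in> carrier_vec m"
    and "\<And>k. k \<in> K \<Longrightarrow> c k \<noteq> 0 \<Longrightarrow> w k \<in> S"
    and "\<And>p. p < m \<Longrightarrow> v $ p = (\<Sum>k\<in>K. c k * w k $ p)"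
  shows "v \<in> vec_span m S"
proof -
  interpret vec_space "TYPE(real)" m .
  show ?thesis
    using assms(2-)
  proof (induction K arbitrary: v)
    case empty
    then have "v = 0\<^sub>v m" by auto
    then show ?case by (auto simp: vec_span_def span_zero)
  next
    case (insert k K)
    define u where "u = Matrix.vec m (\<lambda>p. \<Sum>k\<in>K. c k * w k $ p)"
    have "u \<in> vec_span m S"
      by (rule insert.IH) (use insert.prems in \<open>auto simp: u_def\<close>)
    moreover have "c k \<cdot>\<^sub>v w k \<in> vec_span m S"
      using insert.prems(2)[of k] insert.prems(3)[of k] S
      unfolding vec_span_def by (intro prod_in_span) (use in_own_span[OF S] in auto)
    moreover have "v = c k \<cdot>\<^sub>v w k + u"
      using insert.prems(1,4) insert.prems(2)[of k] insert.hyps by (auto simp: u_def)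
    ultimately show ?case
      using vec_span_add[OF S] by simp
  qed
qed

lemma pair_vec_in_vec_span:
  assumes S: "S \<subseteq> carrier_vec (2 * (N * (N - 1)))" and "finite K"
    and U: "U \<in> carrier_mat N (N - 1)" and V: "V \<in> carrier_mat (N - 1) N"
    and U': "\<And>k. k \<in> K \<Longrightarrow> U' k \<in> carrier_mat N (N - 1)"
    and V': "\<And>k. k \<in> K \<Longrightarrow> V' k \<in> carrier_mat (N - 1) N"
    and in_S: "\<And>k. k \<in> K \<Longrightarrow> c k \<noteq> 0 \<Longrightarrow> pair_vec (U' k) (V' k) \<in> S"
    and eq_U: "\<And>i j. i < N \<Longrightarrow> j < N - 1 \<Longrightarrow> U $$ (i, j) = (\<Sum>k\<in>K. c k * U' k $$ (i, j))"
    and eq_V: "\<And>i j. i < N - 1 \<Longrightarrow> j < N \<Longrightarrow> V $$ (i, j) = (\<Sum>k\<in>K. c k * V' k $$ (i, j))"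
  shows "pair_vec U V \<in> vec_span (2 * (N * (N - 1))) S"
proof (rule vec_span_sum[OF S \<open>finite K\<close> pair_vec_carrier[OF U V]])
  fix p assume p: "p < 2 * (N * (N - 1))"
  have entry: "pair_vec A B $ p = (if p < N * (N - 1) then A $$ (p mod N, p div N)
      else B $$ ((p - N * (N - 1)) mod (N - 1), (p - N * (N - 1)) div (N - 1)))"
    if "A \<in> carrier_mat N (N - 1)" "B \<in> carrier_mat (N - 1) N" for A B
    using that p carrier_matD[OF that(1)] carrier_matD[OF that(2)]
    by (simp add: pair_vec_def vectorize_def mult.commute[of "N - 1" N] del: One_nat_def)
  show "pair_vec U V $ p = (\<Sum>k\<in>K. c k * pair_vec (U' k) (V' k) $ p)"
  proof (cases "p < N * (N - 1)")
    case True
    then have "p div N < N - 1" "p mod N < N"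
      using div_less_of_mult[of p "N - 1" N] by (simp_all add: mult.commute)
    then show ?thesis using True eq_U entry U V U' V' by simp
  next
    case False
    define k where "k = p - N * (N - 1)"
    have "k < N * (N - 1)" using False p by (simp add: k_def del: One_nat_def)
    then have "k div (N - 1) < N" "k mod (N - 1) < N - 1"
      by (rule div_less_of_mult)+
    then show ?thesis using False eq_V entry U V U' V' by (simp add: k_def)
  qed
qed (use pair_vec_carrier U' V' in_S in auto)

section \<open>The problem in the eigenbasis of the Gram matrix\<close>

lemma unit_mat_carrier [simp]: "unit_mat m i j \<in> carrier_mat m m"
  by (simp add: unit_mat_def)

lemma unit_mat_nonzero:
  assumes "i < n" "j < n"
  shows "unit_mat n i j \<noteq> 0\<^sub>m n n"
  using assms by (auto simp: unit_mat_def dest!: arg_cong[of _ _ "\<lambda>A. A $$ (i, j)"])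

text \<open>
  An orthogonal diagonalization $M = Q D Q^{\top}$ of the Gram matrix, with \<open>n\<close> for $N - 1$.
  Positivity of the entries \<open>d j\<close> for \<open>j < n\<close> is a consequence (lemma \<open>d_pos\<close>).
\<close>
locale gram_diagonalization =
  fixes n :: nat and Q :: "real mat" and d :: "nat \<Rightarrow> real"
  assumes Q [simp]: "Q \<in> carrier_mat n n"
    and QQT: "Q * transpose_mat Q = 1\<^sub>m n"
    and QTQ: "transpose_mat Q * Q = 1\<^sub>m n"
    and gram: "gram_mat (Suc n) = Q * mat_diag n d * transpose_mat Q"
begin

abbreviation "M \<equiv> gram_mat (Suc n)"
abbreviation "D \<equiv> mat_diag n d"
abbreviation "QT \<equiv> transpose_mat Q"

lemma M [simp]: "M \<in> carrier_mat n n"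
  using gram_mat_carrier[of "Suc n"] by simp

lemma dims [simp]: "dim_row Q = n" "dim_col Q = n" "dim_row M = n" "dim_col M = n"
  using carrier_matD[OF Q] carrier_matD[OF M] by auto

lemma QT [simp]: "QT \<in> carrier_mat n n"
  by simp

lemma QT_M: "QT * M = D * QT"
proof -
  have "QT * M = QT * (Q * (D * QT))"
    by (simp add: gram assoc_mult_mat[OF Q mat_diag_dim QT])
  also have "\<dots> = (QT * Q) * (D * QT)"
    by (rule assoc_mult_mat[symmetric, OF QT Q, of _ n]) (auto intro!: mult_carrier_mat[of _ _ n])
  also have "\<dots> = D * QT"
    unfolding QTQ by (rule left_mult_one_mat[of _ n n]) (auto intro!: mult_carrier_mat[of _ _ n])
  finally show ?thesis .
qed

lemma M_Q: "M * Q = Q * D"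
  using arg_cong[OF QT_M, of transpose_mat]
  by (simp add: transpose_mult[OF QT M] transpose_mult[OF mat_diag_dim QT] transpose_gram_mat)
    (auto simp: mat_diag_def intro!: arg_cong[of _ _ "(*) Q"] eq_matI)

lemma M_mult_col:
  assumes "j < n"
  shows "M *\<^sub>v col Q j = d j \<cdot>\<^sub>v col Q j"
proof -
  have "M *\<^sub>v col Q j = col (M * Q) j"
    using assms by (simp add: col_mult2[OF M Q])
  also have "\<dots> = d j \<cdot>\<^sub>v col Q j"
    using assms carrier_matD[OF Q] by (auto simp: M_Q mat_diag_mult_right[OF Q] mult.commute intro!: eq_vecI)
  finally show ?thesis .
qed

lemma scalar_prod_col:
  assumes "i < n" "j < n"
  shows "scalar_prod (col Q i) (col Q j) = (if i = j then 1 else 0)"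
  using arg_cong[OF QTQ, of "\<lambda>A. A $$ (i, j)"] assms Q by simp

lemma col_nonzero:
  assumes "j < n"
  shows "col Q j \<noteq> 0\<^sub>v n"
  using scalar_prod_col[OF assms assms] Q by auto

lemma d_pos:
  assumes "j < n"
  shows "d j > 0"
proof -
  have "0 < scalar_prod (col Q j) (M *\<^sub>v col Q j)"
    using assms Q by (intro gram_mat_pos_def col_nonzero) auto
  also have "\<dots> = d j"
    using assms Q by (simp add: M_mult_col scalar_prod_col)
  finally show ?thesis .
qed

text \<open>
  The matrix $Q I_{ij} Q^{\top}$, that is, the product of column \<open>i\<close> and the transpose of
  column \<open>j\<close> of \<open>Q\<close>. It is an eigenvector both of left and of right multiplication by \<open>M\<close>.
\<close>
definition outer :: "nat \<Rightarrow> nat \<Rightarrow> real mat" where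
  "outer i j = Q * unit_mat n i j * QT"

lemma outer_carrier [simp]: "outer i j \<in> carrier_mat n n"
  unfolding outer_def by (intro mult_carrier_mat[of _ _ n]) auto

lemma outer_dims [simp]: "dim_row (outer i j) = n" "dim_col (outer i j) = n"
  using carrier_matD[OF outer_carrier] by auto

lemma outer_index:
  assumes "i < n" "j < n" "r < n" "s < n"
  shows "outer i j $$ (r, s) = Q $$ (r, i) * Q $$ (s, j)"
proof -
  have "Q * unit_mat n i j = Matrix.mat n n (\<lambda>(k, l). if l = j then Q $$ (k, i) else 0)"
    using assms carrier_matD[OF Q]
    by (auto simp: unit_mat_def scalar_prod_def if_distrib[of "\<lambda>x. _ * x"] cong: if_cong intro!: eq_matI)
  then show ?thesis
    using assms carrier_matD[OF Q]
    by (simp add: outer_def scalar_prod_def if_distrib[of "\<lambda>x. x * _"] cong: if_cong)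
qed

lemma M_mult_outer:
  assumes "i < n" "j < n"
  shows "M * outer i j = d i \<cdot>\<^sub>m outer i j"
proof (rule eq_matI)
  fix r s assume "r < dim_row (d i \<cdot>\<^sub>m outer i j)" "s < dim_col (d i \<cdot>\<^sub>m outer i j)"
  then have rs: "r < n" "s < n" using outer_carrier[of i j] by auto
  have "(M * outer i j) $$ (r, s) = (\<Sum>k<n. M $$ (r, k) * Q $$ (k, i)) * Q $$ (s, j)"
    using rs assms
    by (simp add: scalar_prod_def outer_index lessThan_atLeast0 sum_distrib_left sum_distrib_right mult_ac)
  also have "(\<Sum>k<n. M $$ (r, k) * Q $$ (k, i)) = (M *\<^sub>v col Q i) $ r"
    using rs assms M Q by (simp add: scalar_prod_def lessThan_atLeast0)
  finally show "(M * outer i j) $$ (r, s) = (d i \<cdot>\<^sub>m outer i j) $$ (r, s)"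
    using rs assms Q outer_carrier[of i j] by (simp add: M_mult_col outer_index)
qed (use outer_carrier[of i j] in auto)

lemma transpose_outer:
  assumes "i < n" "j < n"
  shows "transpose_mat (outer i j) = outer j i"
  using assms by (auto simp: outer_index intro!: eq_matI)

lemma outer_mult_M:
  assumes "i < n" "j < n"
  shows "outer i j * M = d j \<cdot>\<^sub>m outer i j"
proof -
  have "outer i j * M = transpose_mat (M * outer j i)"
    using assms by (simp add: transpose_mult[OF M outer_carrier] transpose_outer transpose_gram_mat)
  also have "\<dots> = d j \<cdot>\<^sub>m outer i j"
    using assms by (auto simp: M_mult_outer outer_index intro!: eq_matI)
  finally show ?thesis .
qed

lemma outer_nonzero:
  assumes "i < n" "j < n"
  shows "outer i j \<noteq> 0\<^sub>m n n"
proof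
  assume 0: "outer i j = 0\<^sub>m n n"
  obtain r s where "r < n" "col Q i $ r \<noteq> 0" "s < n" "col Q j $ s \<noteq> 0"
    using col_nonzero[OF assms(1)] col_nonzero[OF assms(2)] Q
    by (metis carrier_matD(1) dim_col eq_vecI index_zero_vec)
  then show False
    using outer_index[OF assms, of r s] 0 assms Q by simp
qed

text \<open>Expansion of a vector in the orthonormal basis of the columns of \<open>Q\<close>.\<close>
lemma sum_cols:
  assumes a: "a \<in> carrier_vec n" and "r < n"
  shows "a $ r = (\<Sum>j<n. (QT *\<^sub>v a) $ j * col Q j $ r)"
proof -
  have "a = Q *\<^sub>v (QT *\<^sub>v a)"
    using assoc_mult_mat_vec[OF Q QT a] a by (simp add: QQT)
  then have "a $ r = (Q *\<^sub>v (QT *\<^sub>v a)) $ r" by simp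
  also have "\<dots> = (\<Sum>j<n. (QT *\<^sub>v a) $ j * col Q j $ r)"
    using \<open>r < n\<close> by (simp add: scalar_prod_def lessThan_atLeast0 mult.commute)
  finally show ?thesis .
qed

text \<open>Expansion of a matrix in the basis of the \<^term>\<open>outer i j\<close>.\<close>
lemma sum_outer:
  assumes X: "X \<in> carrier_mat n n" and "r < n" "s < n"
  shows "X $$ (r, s) = (\<Sum>(i, j)\<in>{..<n} \<times> {..<n}. (QT * X * Q) $$ (i, j) * outer i j $$ (r, s))"
proof -
  define Z where "Z = QT * X * Q"
  have C: "Z \<in> carrier_mat n n" using X unfolding Z_def by (auto intro!: mult_carrier_mat[of _ _ n])
  have "X = (Q * QT) * X * (Q * QT)"
    using X by (simp add: QQT)
  also have "\<dots> = Q * (QT * X * Q) * QT"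
    using X by (simp add: assoc_mult_mat[of _ n n _ n _ n] mult_carrier_mat[of _ n n _ n])
  finally have "X $$ (r, s) = (Q * Z * QT) $$ (r, s)" by (simp add: Z_def)
  also have "\<dots> = (\<Sum>j<n. (\<Sum>i<n. Q $$ (r, i) * Z $$ (i, j)) * Q $$ (s, j))"
    using assms(2,3) carrier_matD[OF C]
    by (simp add: scalar_prod_def lessThan_atLeast0 del: assoc_mult_mat)
  also have "\<dots> = (\<Sum>j<n. \<Sum>i<n. Z $$ (i, j) * outer i j $$ (r, s))"
    using assms(2,3) by (simp add: sum_distrib_left sum_distrib_right outer_index mult_ac)
  also have "\<dots> = (\<Sum>i<n. \<Sum>j<n. Z $$ (i, j) * outer i j $$ (r, s))"
    by (rule sum.swap)
  finally show ?thesis by (simp add: sum.cartesian_product Z_def del: index_mult_mat(1))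
qed

section \<open>The listed triples are eigen-solutions\<close>

lemma outer_smult: "- (Q * (c \<cdot>\<^sub>m unit_mat n i j) * QT) = (- c) \<cdot>\<^sub>m outer i j"
proof -
  have "Q * (c \<cdot>\<^sub>m unit_mat n i j) * QT = c \<cdot>\<^sub>m outer i j"
    unfolding outer_def mult_smult_distrib[OF Q unit_mat_carrier]
    by (rule mult_smult_assoc_mat[OF mult_carrier_mat[OF Q unit_mat_carrier] QT])
  then show ?thesis by (auto intro!: eq_matI)
qed

lemma solutions_A1_eq:
  "solutions_A1 (Suc n) Q d = {(1 / d i + 1 / d j, row_block (0\<^sub>v n) (outer i j),
      col_block (0\<^sub>v n) ((- (d j / d i)) \<cdot>\<^sub>m outer i j)) | i j. i < n \<and> j < n}"
  unfolding solutions_A1_def diff_Suc_1 outer_smult outer_def ..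

lemma eigen_solution_A1:
  assumes "(\<mu>, U, V) \<in> solutions_A1 (Suc n) Q d"
  shows "eigen_solution (Suc n) \<mu> U V"
proof -
  from assms obtain i j where ij: "i < n" "j < n" and \<mu>: "\<mu> = 1 / d i + 1 / d j"
    and U: "U = row_block (0\<^sub>v n) (outer i j)"
    and V: "V = col_block (0\<^sub>v n) ((- (d j / d i)) \<cdot>\<^sub>m outer i j)"
    by (auto simp: solutions_A1_eq)
  have pos: "d i > 0" "d j > 0" using ij d_pos by auto
  have "outer i j - (- (d j / d i)) \<cdot>\<^sub>m outer i j = \<mu> \<cdot>\<^sub>m (outer i j * M)"
    unfolding outer_mult_M[OF ij] using pos by (auto simp: \<mu> field_simps intro!: eq_matI)
  moreover have "(- (d j / d i)) \<cdot>\<^sub>m outer i j - outer i j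
      = \<mu> \<cdot>\<^sub>m (M * ((- (d j / d i)) \<cdot>\<^sub>m outer i j))"
    unfolding mult_smult_distrib[OF M outer_carrier] M_mult_outer[OF ij]
    using pos by (auto simp: \<mu> field_simps intro!: eq_matI)
  ultimately show ?thesis
    unfolding U V using outer_nonzero[OF ij] by (subst eigen_solution_block_iff) auto
qed

lemma eigen_solution_A2:
  assumes "(\<mu>, U, V) \<in> solutions_A2 (Suc n) Q d"
  shows "eigen_solution (Suc n) \<mu> U V"
proof -
  from assms obtain j where j: "j < n" and \<mu>: "\<mu> = 1 / d j"
    and UV: "U = row_block (col Q j) (0\<^sub>m n n)" "V = col_block (0\<^sub>v n) (0\<^sub>m n n)"
    by (auto simp: solutions_A2_def)
  have "col Q j = \<mu> \<cdot>\<^sub>v (M *\<^sub>v col Q j)"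
    using d_pos[OF j] j by (auto simp: M_mult_col \<mu>)
  then show ?thesis
    unfolding UV using col_nonzero[OF j] j by (subst eigen_solution_block_iff) auto
qed

lemma eigen_solution_A3:
  assumes "(\<mu>, U, V) \<in> solutions_A3 (Suc n) Q d"
  shows "eigen_solution (Suc n) \<mu> U V"
proof -
  from assms obtain j where j: "j < n" and \<mu>: "\<mu> = 1 / d j"
    and UV: "U = row_block (0\<^sub>v n) (0\<^sub>m n n)" "V = col_block (col Q j) (0\<^sub>m n n)"
    by (auto simp: solutions_A3_def)
  have "col Q j = \<mu> \<cdot>\<^sub>v (M *\<^sub>v col Q j)"
    using d_pos[OF j] j by (auto simp: M_mult_col \<mu>)
  then show ?thesis
    unfolding UV using col_nonzero[OF j] j by (subst eigen_solution_block_iff) auto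
qed

lemma eigen_solution_B:
  assumes "(\<mu>, U, V) \<in> solutions_B (Suc n)"
  shows "eigen_solution (Suc n) \<mu> U V"
proof -
  from assms obtain i j where ij: "i < n" "j < n" and \<mu>: "\<mu> = 0"
    and UV: "U = row_block (0\<^sub>v n) (unit_mat n i j)" "V = col_block (0\<^sub>v n) (unit_mat n i j)"
    by (auto simp: solutions_B_def)
  have zero: "unit_mat n i j - unit_mat n i j = \<mu> \<cdot>\<^sub>m A" if "A \<in> carrier_mat n n" for A
    using that carrier_matD[OF unit_mat_carrier[of n i j]] by (auto simp: \<mu> intro!: eq_matI)
  show ?thesis
    unfolding UV
      eigen_solution_block_iff[OF zero_carrier_vec unit_mat_carrier zero_carrier_vec unit_mat_carrier]
    using unit_mat_nonzero[OF ij] zero[OF mult_carrier_mat[OF unit_mat_carrier M]]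
      zero[OF mult_carrier_mat[OF M unit_mat_carrier]]
    by auto
qed

lemma nonzero_solutions_nonzero:
  assumes "(\<mu>, U, V) \<in> nonzero_solutions (Suc n) Q d"
  shows "\<mu> \<noteq> 0"
proof -
  have "1 / d i + 1 / d j > 0" "1 / d j > 0" if "i < n" "j < n" for i j
    using that d_pos by (simp_all add: add_pos_pos)
  then show ?thesis
    using assms unfolding nonzero_solutions_def solutions_A1_def solutions_A2_def solutions_A3_def
    by fastforce
qed

lemma eigen_solution_listed:
  assumes "(\<mu>, U, V) \<in> nonzero_solutions (Suc n) Q d \<union> solutions_B (Suc n)"
  shows "eigen_solution (Suc n) \<mu> U V"
  using assms eigen_solution_A1 eigen_solution_A2 eigen_solution_A3 eigen_solution_B
  by (auto simp: nonzero_solutions_def)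

section \<open>The listed eigenvectors span the eigenspaces\<close>

text \<open>The vectorized eigenvectors listed for the eigenvalue \<open>\<mu>\<close>.\<close>
definition listed :: "real \<Rightarrow> real Matrix.vec set" where
  "listed \<mu> = {pair_vec U V | U V.
     (\<mu>, U, V) \<in> nonzero_solutions (Suc n) Q d \<union> solutions_B (Suc n)}"

text \<open>The length of the vectors \<^term>\<open>pair_vec U V\<close>.\<close>
abbreviation "pair_dim \<equiv> 2 * (Suc n * (Suc n - 1))"

lemma listed_carrier: "listed \<mu> \<subseteq> carrier_vec pair_dim"
  using eigen_solution_listed pair_vec_carrier unfolding listed_def eigen_solution_def by blast

text \<open>
  An \<open>a\<close> with $a = \mu M a$ has non-zero coordinates in the eigenbasis only where $1 = \mu d_j$.
\<close>
lemma eigenvector_coeff: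
  assumes a: "a \<in> carrier_vec n" and eq: "a = \<mu> \<cdot>\<^sub>v (M *\<^sub>v a)"
    and "j < n" and "(QT *\<^sub>v a) $ j \<noteq> 0"
  shows "\<mu> = 1 / d j"
proof -
  have "QT *\<^sub>v a = \<mu> \<cdot>\<^sub>v (QT *\<^sub>v (M *\<^sub>v a))"
    using arg_cong[OF eq, of "\<lambda>x. QT *\<^sub>v x"] mult_mat_vec[OF QT mult_mat_vec_carrier[OF M a]] by simp
  also have "QT *\<^sub>v (M *\<^sub>v a) = (D * QT) *\<^sub>v a"
    by (simp add: assoc_mult_mat_vec[OF QT M a, symmetric] QT_M)
  also have "\<dots> = D *\<^sub>v (QT *\<^sub>v a)"
    by (rule assoc_mult_mat_vec[OF mat_diag_dim QT a])
  finally have "(QT *\<^sub>v a) $ j = (\<mu> \<cdot>\<^sub>v (D *\<^sub>v (QT *\<^sub>v a))) $ j" by simp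
  also have "\<dots> = \<mu> * d j * (QT *\<^sub>v a) $ j"
    using \<open>j < n\<close> a
    by (simp add: mat_diag_def scalar_prod_def if_distrib[of "\<lambda>x. x * _"] cong: if_cong)
  finally show ?thesis using assms(4) d_pos[OF \<open>j < n\<close>] by (simp add: field_simps)
qed

lemma row_in_span:
  assumes a: "a \<in> carrier_vec n" and eq: "a = \<mu> \<cdot>\<^sub>v (M *\<^sub>v a)"
  shows "pair_vec (row_block a (0\<^sub>m n n)) (col_block (0\<^sub>v n) (0\<^sub>m n n)) \<in> vec_span pair_dim (listed \<mu>)"
proof (rule pair_vec_in_vec_span[OF listed_carrier, where K = "{..<n}" and c = "\<lambda>j. (QT *\<^sub>v a) $ j"
    and U' = "\<lambda>j. row_block (col Q j) (0\<^sub>m n n)" and V' = "\<lambda>j. col_block (0\<^sub>v n) (0\<^sub>m n n)"])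
  fix j assume "j \<in> {..<n}" "(QT *\<^sub>v a) $ j \<noteq> 0"
  then show "pair_vec (row_block (col Q j) (0\<^sub>m n n)) (col_block (0\<^sub>v n) (0\<^sub>m n n)) \<in> listed \<mu>"
    using eigenvector_coeff[OF a eq, of j]
    by (auto simp: listed_def nonzero_solutions_def solutions_A2_def)
next
  fix i j assume "i < Suc n" "j < Suc n - 1"
  then show "row_block a (0\<^sub>m n n) $$ (i, j)
      = (\<Sum>k<n. (QT *\<^sub>v a) $ k * row_block (col Q k) (0\<^sub>m n n) $$ (i, j))"
    using a sum_cols[OF a, of j] by simp
qed (use a in auto)

lemma col_in_span:
  assumes b: "b \<in> carrier_vec n" and eq: "b = \<mu> \<cdot>\<^sub>v (M *\<^sub>v b)"
  shows "pair_vec (row_block (0\<^sub>v n) (0\<^sub>m n n)) (col_block b (0\<^sub>m n n)) \<in> vec_span pair_dim (listed \<mu>)"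
proof (rule pair_vec_in_vec_span[OF listed_carrier, where K = "{..<n}" and c = "\<lambda>j. (QT *\<^sub>v b) $ j"
    and U' = "\<lambda>j. row_block (0\<^sub>v n) (0\<^sub>m n n)" and V' = "\<lambda>j. col_block (col Q j) (0\<^sub>m n n)"])
  fix j assume "j \<in> {..<n}" "(QT *\<^sub>v b) $ j \<noteq> 0"
  then show "pair_vec (row_block (0\<^sub>v n) (0\<^sub>m n n)) (col_block (col Q j) (0\<^sub>m n n)) \<in> listed \<mu>"
    using eigenvector_coeff[OF b eq, of j]
    by (auto simp: listed_def nonzero_solutions_def solutions_A3_def)
next
  fix i j assume "i < Suc n - 1" "j < Suc n"
  then show "col_block b (0\<^sub>m n n) $$ (i, j)
      = (\<Sum>k<n. (QT *\<^sub>v b) $ k * col_block (col Q k) (0\<^sub>m n n) $$ (i, j))"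
    using b sum_cols[OF b, of i] by simp
qed (use b in auto)

lemma block_in_span_zero:
  assumes X: "X \<in> carrier_mat n n"
  shows "pair_vec (row_block (0\<^sub>v n) X) (col_block (0\<^sub>v n) X) \<in> vec_span pair_dim (listed 0)"
proof -
  have entry: "X $$ (r, s) = (\<Sum>k\<in>{..<n} \<times> {..<n}. X $$ k * unit_mat n (fst k) (snd k) $$ (r, s))"
    if "r < n" "s < n" for r s
  proof -
    have "(\<Sum>k\<in>{..<n} \<times> {..<n}. X $$ k * unit_mat n (fst k) (snd k) $$ (r, s))
        = (\<Sum>k\<in>{..<n} \<times> {..<n}. if k = (r, s) then X $$ k else 0)"
      using that by (intro sum.cong) (auto simp: unit_mat_def)
    also have "\<dots> = X $$ (r, s)"
      using that by (simp add: sum.delta)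
    finally show ?thesis by simp
  qed
  show ?thesis
  proof (rule pair_vec_in_vec_span[OF listed_carrier, where K = "{..<n} \<times> {..<n}"
      and c = "\<lambda>k. X $$ k"
      and U' = "\<lambda>k. row_block (0\<^sub>v n) (unit_mat n (fst k) (snd k))"
      and V' = "\<lambda>k. col_block (0\<^sub>v n) (unit_mat n (fst k) (snd k))"])
    fix k assume "k \<in> {..<n} \<times> {..<n}"
    then show "pair_vec (row_block (0\<^sub>v n) (unit_mat n (fst k) (snd k)))
        (col_block (0\<^sub>v n) (unit_mat n (fst k) (snd k))) \<in> listed 0"
      by (fastforce simp: listed_def solutions_B_def)
  next
    fix i j assume "i < Suc n" "j < Suc n - 1"
    then show "row_block (0\<^sub>v n) X $$ (i, j) = (\<Sum>k\<in>{..<n} \<times> {..<n}. X $$ k *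
        row_block (0\<^sub>v n) (unit_mat n (fst k) (snd k)) $$ (i, j))"
      using X entry[of "i - 1" j] carrier_matD[OF unit_mat_carrier[of n]] by (cases i) auto
  next
    fix i j assume "i < Suc n - 1" "j < Suc n"
    then show "col_block (0\<^sub>v n) X $$ (i, j) = (\<Sum>k\<in>{..<n} \<times> {..<n}. X $$ k *
        col_block (0\<^sub>v n) (unit_mat n (fst k) (snd k)) $$ (i, j))"
      using X entry[of i "j - 1"] carrier_matD[OF unit_mat_carrier[of n]] by (cases j) auto
  qed (use X in auto)
qed

text \<open>
  In the eigenbasis the coupled equations read $x_{ij} - y_{ij} = \mu d_j x_{ij}$ and
  $y_{ij} - x_{ij} = \mu d_i y_{ij}$. Their sum gives $y_{ij} = -(d_j / d_i) x_{ij}$ because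
  $\mu \neq 0$; inserting this into the first gives $x_{ij} = 0$ or $\mu = 1/d_i + 1/d_j$.
\<close>
lemma block_in_span_nonzero:
  assumes X: "X \<in> carrier_mat n n" and Y: "Y \<in> carrier_mat n n"
    and XY: "X - Y = \<mu> \<cdot>\<^sub>m (X * M)" and YX: "Y - X = \<mu> \<cdot>\<^sub>m (M * Y)" and "\<mu> \<noteq> 0"
  shows "pair_vec (row_block (0\<^sub>v n) X) (col_block (0\<^sub>v n) Y) \<in> vec_span pair_dim (listed \<mu>)"
proof -
  define x where "x = (\<lambda>(i, j). (QT * X * Q) $$ (i, j))"
  define y where "y = (\<lambda>(i, j). (QT * Y * Q) $$ (i, j))"
  have C: "QT * A * Q \<in> carrier_mat n n" if "A \<in> carrier_mat n n" for A
    using that by (auto intro!: mult_carrier_mat[of _ _ n])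
  have conj_minus: "QT * (A - B) * Q = QT * A * Q - QT * B * Q"
    if "A \<in> carrier_mat n n" "B \<in> carrier_mat n n" for A B
    using that minus_mult_distrib_mat[of "QT * A" n n "QT * B" Q n]
    by (simp add: mult_minus_distrib_mat[OF QT] mult_carrier_mat[OF QT] del: assoc_mult_mat)
  have conj_smult: "QT * (c \<cdot>\<^sub>m A) * Q = c \<cdot>\<^sub>m (QT * A * Q)" if "A \<in> carrier_mat n n" for A c
    using that mult_smult_assoc_mat[of "QT * A" n n Q n c]
    by (simp add: mult_smult_distrib[OF QT] mult_carrier_mat[OF QT] del: assoc_mult_mat)
  have XM: "QT * (X * M) * Q = (QT * X * Q) * D"
    using X by (simp add: assoc_mult_mat[of _ n n _ n _ n] mult_carrier_mat[of _ n n _ n] M_Q)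
  have MY: "QT * (M * Y) * Q = D * (QT * Y * Q)"
  proof -
    have "QT * (M * Y) * Q = (QT * M) * Y * Q"
      using Y by (simp add: assoc_mult_mat[of _ n n _ n _ n] mult_carrier_mat[of _ n n _ n])
    also have "\<dots> = D * (QT * Y * Q)"
      unfolding QT_M
      using Y by (simp add: assoc_mult_mat[of _ n n _ n _ n] mult_carrier_mat[of _ n n _ n])
    finally show ?thesis .
  qed
  have eqs: "x (i, j) - y (i, j) = \<mu> * d j * x (i, j)" "y (i, j) - x (i, j) = \<mu> * d i * y (i, j)"
    if "i < n" "j < n" for i j
  proof -
    have "QT * X * Q - QT * Y * Q = \<mu> \<cdot>\<^sub>m (Matrix.mat n n (\<lambda>(i, j). (QT * X * Q) $$ (i, j) * d j))"
      using arg_cong[OF XY, of "\<lambda>A. QT * A * Q"] conj_minus[OF X Y]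
        conj_smult[OF mult_carrier_mat[OF X M]] mat_diag_mult_right[OF C[OF X], of d]
      by (simp add: XM del: assoc_mult_mat)
    from arg_cong[OF this, of "\<lambda>A. A $$ (i, j)"]
    show "x (i, j) - y (i, j) = \<mu> * d j * x (i, j)"
      using that carrier_matD[OF C[OF X]] carrier_matD[OF C[OF Y]]
      by (simp add: x_def y_def mult.commute del: assoc_mult_mat index_mult_mat(1))
    have "QT * Y * Q - QT * X * Q = \<mu> \<cdot>\<^sub>m (Matrix.mat n n (\<lambda>(i, j). d i * (QT * Y * Q) $$ (i, j)))"
      using arg_cong[OF YX, of "\<lambda>A. QT * A * Q"] conj_minus[OF Y X]
        conj_smult[OF mult_carrier_mat[OF M Y]] mat_diag_mult_left[OF C[OF Y], of d]
      by (simp add: MY del: assoc_mult_mat)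
    from arg_cong[OF this, of "\<lambda>A. A $$ (i, j)"]
    show "y (i, j) - x (i, j) = \<mu> * d i * y (i, j)"
      using that carrier_matD[OF C[OF X]] carrier_matD[OF C[OF Y]]
      by (simp add: x_def y_def mult.assoc del: assoc_mult_mat index_mult_mat(1))
  qed
  have y_eq: "y (i, j) = - (d j / d i) * x (i, j)" if "i < n" "j < n" for i j
  proof -
    \<comment> \<open>the sum of the two equations\<close>
    have "\<mu> * (d j * x (i, j) + d i * y (i, j)) = 0"
      using eqs[OF that] by (simp add: algebra_simps)
    then have "d j * x (i, j) + d i * y (i, j) = 0"
      using \<open>\<mu> \<noteq> 0\<close> by simp
    then show ?thesis
      using d_pos[OF that(1)] by (simp add: field_simps)
  qed
  have \<mu>_eq: "\<mu> = 1 / d i + 1 / d j" if "i < n" "j < n" "x (i, j) \<noteq> 0" for i j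
  proof -
    have "(1 + d j / d i) * x (i, j) = \<mu> * d j * x (i, j)"
      using eqs(1)[OF that(1,2)] y_eq[OF that(1,2)] by (simp add: algebra_simps)
    then have "1 + d j / d i = \<mu> * d j"
      using that(3) by simp
    then show ?thesis
      using d_pos[OF that(1)] d_pos[OF that(2)] by (simp add: field_simps)
  qed
  have X_entry: "X $$ (r, s) = (\<Sum>k\<in>{..<n} \<times> {..<n}. x k * outer (fst k) (snd k) $$ (r, s))"
    if "r < n" "s < n" for r s
    unfolding sum_outer[OF X that] by (intro sum.cong) (auto simp: x_def)
  have Y_entry: "Y $$ (r, s) = (\<Sum>k\<in>{..<n} \<times> {..<n}.
      x k * ((- (d (snd k) / d (fst k))) \<cdot>\<^sub>m outer (fst k) (snd k)) $$ (r, s))"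
    if "r < n" "s < n" for r s
    unfolding sum_outer[OF Y that]
  proof (intro sum.cong refl)
    fix k assume "k \<in> {..<n} \<times> {..<n}"
    then obtain i j where k: "k = (i, j)" "i < n" "j < n" by auto
    then show "(case k of (i, j) \<Rightarrow> (QT * Y * Q) $$ (i, j) * outer i j $$ (r, s))
        = x k * ((- (d (snd k) / d (fst k))) \<cdot>\<^sub>m outer (fst k) (snd k)) $$ (r, s)"
      using y_eq[of i j] that by (simp add: y_def del: assoc_mult_mat index_mult_mat(1))
  qed
  show ?thesis
  proof (rule pair_vec_in_vec_span[OF listed_carrier, where K = "{..<n} \<times> {..<n}" and c = x
      and U' = "\<lambda>k. row_block (0\<^sub>v n) (outer (fst k) (snd k))"
      and V' = "\<lambda>k. col_block (0\<^sub>v n) ((- (d (snd k) / d (fst k))) \<cdot>\<^sub>m outer (fst k) (snd k))"])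
    fix k assume "k \<in> {..<n} \<times> {..<n}" "x k \<noteq> 0"
    then show "pair_vec (row_block (0\<^sub>v n) (outer (fst k) (snd k)))
        (col_block (0\<^sub>v n) ((- (d (snd k) / d (fst k))) \<cdot>\<^sub>m outer (fst k) (snd k))) \<in> listed \<mu>"
      using \<mu>_eq[of "fst k" "snd k"]
      unfolding listed_def nonzero_solutions_def solutions_A1_eq by fastforce
  next
    fix i j assume "i < Suc n" "j < Suc n - 1"
    then show "row_block (0\<^sub>v n) X $$ (i, j) = (\<Sum>k\<in>{..<n} \<times> {..<n}. x k *
        row_block (0\<^sub>v n) (outer (fst k) (snd k)) $$ (i, j))"
      using X X_entry[of "i - 1" j] by (cases i) auto
  next
    fix i j assume "i < Suc n - 1" "j < Suc n"
    then show "col_block (0\<^sub>v n) Y $$ (i, j) = (\<Sum>k\<in>{..<n} \<times> {..<n}. x k *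
        col_block (0\<^sub>v n) ((- (d (snd k) / d (fst k))) \<cdot>\<^sub>m outer (fst k) (snd k)) $$ (i, j))"
      using Y Y_entry[of i "j - 1"] by (cases j) auto
  qed (use X Y in auto)
qed

lemma eigen_solution_in_span:
  assumes "eigen_solution (Suc n) \<mu> U V"
  shows "pair_vec U V \<in> vec_span pair_dim (listed \<mu>)"
proof -
  have "U \<in> carrier_mat (Suc n) n" "V \<in> carrier_mat n (Suc n)"
    using assms by (auto simp: eigen_solution_def)
  then obtain a X b Y where a: "a \<in> carrier_vec n" and X: "X \<in> carrier_mat n n"
    and b: "b \<in> carrier_vec n" and Y: "Y \<in> carrier_mat n n"
    and U: "U = row_block a X" and V: "V = col_block b Y"
    by (metis row_block_cases col_block_cases)
  from assms have eqs: "a = \<mu> \<cdot>\<^sub>v (M *\<^sub>v a)" "b = \<mu> \<cdot>\<^sub>v (M *\<^sub>v b)"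
    "X - Y = \<mu> \<cdot>\<^sub>m (X * M)" "Y - X = \<mu> \<cdot>\<^sub>m (M * Y)"
    unfolding U V eigen_solution_block_iff[OF a X b Y] by blast+
  have XY: "pair_vec (row_block (0\<^sub>v n) X) (col_block (0\<^sub>v n) Y) \<in> vec_span pair_dim (listed \<mu>)"
  proof (cases "\<mu> = 0")
    case True
    have "X $$ (i, j) = Y $$ (i, j)" if "i < n" "j < n" for i j
      using arg_cong[OF eqs(3), of "\<lambda>A. A $$ (i, j)"] X Y that True by simp
    then have "X = Y" using X Y by (intro eq_matI) auto
    then show ?thesis using block_in_span_zero[OF X] True by simp
  qed (use block_in_span_nonzero[OF X Y eqs(3,4)] in auto)
  let ?O = "0\<^sub>m n n :: real mat" and ?o = "0\<^sub>v n :: real Matrix.vec"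
  have "U = row_block a ?O + row_block ?o ?O + row_block ?o X"
    unfolding U using a X by (intro eq_row_blockI[symmetric]) auto
  moreover have "V = col_block ?o ?O + col_block b ?O + col_block ?o Y"
    unfolding V using b Y by (intro eq_col_blockI[symmetric]) auto
  moreover have "pair_vec (row_block a ?O + row_block ?o ?O + row_block ?o X)
        (col_block ?o ?O + col_block b ?O + col_block ?o Y)
      = pair_vec (row_block a ?O) (col_block ?o ?O) + pair_vec (row_block ?o ?O) (col_block b ?O)
        + pair_vec (row_block ?o X) (col_block ?o Y)"
    using a b X Y by (simp add: pair_vec_add[of _ "Suc n" n])
  ultimately show ?thesis
    using vec_span_add[OF listed_carrier] row_in_span[OF a eqs(1)] col_in_span[OF b eqs(2)] XY
    by simp
qed

end

section \<open>The complete list of eigen-solutions\<close>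

theorem theorem2p1:
  fixes N :: nat and Q :: "real mat" and d :: "nat \<Rightarrow> real"
  assumes "N \<ge> 2"
    and "Q \<in> carrier_mat (N - 1) (N - 1)"
    and "Q * transpose_mat Q = 1\<^sub>m (N - 1)"
    and "transpose_mat Q * Q = 1\<^sub>m (N - 1)"
    and "gram_mat N = Q * mat_diag (N - 1) d * transpose_mat Q"
  shows "(\<forall>(\<mu>, U, V) \<in> nonzero_solutions N Q d. eigen_solution N \<mu> U V \<and> \<mu> \<noteq> 0) \<and>
    (\<forall>(\<mu>, U, V) \<in> solutions_B N. eigen_solution N \<mu> U V) \<and>
    (\<forall>\<mu> U V. eigen_solution N \<mu> U V \<longrightarrow>
       pair_vec U V \<in> vec_span (2 * (N * (N - 1)))
         {pair_vec U' V' | U' V'. (\<mu>, U', V') \<in> nonzero_solutions N Q d \<union> solutions_B N})"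
proof -
  define n where "n = N - 1"
  have N: "N = Suc n" using assms(1) by (simp add: n_def)
  interpret gram_diagonalization n Q d
    by unfold_locales (use assms in \<open>simp_all add: N\<close>)
  show ?thesis
    using eigen_solution_listed nonzero_solutions_nonzero eigen_solution_in_span
    unfolding N listed_def by blast
qed

end
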